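(* Let $\mathrm{st}:\mathfrak{S}\to\mathbb{N}$ be a permutation statistic for which there is a function $f:\mathbb{N}^2\to\mathbb{N}$ such that for all integers $0\le k\le n$ and all $\sigma_1\in\mathfrak{S}_k(312)$, $\sigma_2\in\mathfrak{S}_{n-k}(312)$, the permutation $\sigma=213[\sigma_1,1,\sigma_2]$ satisfies $$\mathrm{st}(\sigma)=f(k,n-k)+\mathrm{st}(\sigma_1)+\mathrm{st}(\sigma_2).$$ Let $r\ge 0$ and let $\pi_1,\dots,\pi_r,\pi'_1,\dots,\pi'_r$ be permutations such that, for every $i\in\{1,\dots,r\}$, the sets $\{312,\pi_i\}$ and $\{312,\pi'_i\}$ are $\mathrm{st}$-Wilf equivalent. Set $\pi=\iota_r[\pi_{1*},\dots,\pi_{r*}]$ and $\pi'=\iota_r[\pi'_{1*},\dots,\pi'_{r*}]$. Then $\{312,\pi\}$ and $\{312,\pi'\}$ are also $\mathrm{st}$-Wilf equivalent, i.e. $F^{\mathrm{st}}_n(\{312,\pi\};q)=F^{\mathrm{st}}_n(\{312,\pi'\};q)$ for all $n\ge 0$.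
   Context: $\mathbb{N}$ is the set of nonnegative integers. $\mathfrak{S}_n$ is the set of permutations of $\{1,\dots,n\}$ in one-line notation, $\mathfrak{S}=\bigcup_{n\ge 0}\mathfrak{S}_n$, and $\mathfrak{S}_0=\{\epsilon\}$ with $\epsilon$ the empty permutation. A permutation $\sigma$ contains $\pi$ if some subsequence of $\sigma$ has the same relative order as $\pi$ (so every permutation contains $\epsilon$); otherwise $\sigma$ avoids $\pi$. For $\Pi\subseteq\mathfrak{S}$, $\mathfrak{S}_n(\Pi)$ is the set of $\sigma\in\mathfrak{S}_n$ avoiding every pattern in $\Pi$; $\mathfrak{S}_n(312)=\mathfrak{S}_n(\{312\})$. For a statistic $\mathrm{st}:\mathfrak{S}\to\mathbb{N}$, $F^{\mathrm{st}}_n(\Pi;q)=\sum_{\sigma\in\mathfrak{S}_n(\Pi)}q^{\mathrm{st}(\sigma)}$, and $\Pi,\Pi'$ are $\mathrm{st}$-Wilf equivalent if $F^{\mathrm{st}}_n(\Pi;q)=F^{\mathrm{st}}_n(\Pi';q)$ for all $n\ge 0$. For $\tau\in\mathfrak{S}_k$ and $\sigma_1,\dots,\sigma_k\in\mathfrak{S}$, the inflation $\tau[\sigma_1,\dots,\sigma_k]$ is the permutation that is a concatenation of $k$ consecutive blocks of positions, the $i$-th block (of length $|\sigma_i|$) having the relative order of $\sigma_i$ and occupying an interval of values, with the blocks' value intervals arranged relative to one another in the order of $\tau$; e.g. $213[123,1,21]=234165$. $\iota_r=12\cdots r$ is the identity of $\mathfrak{S}_r$ (and $\iota_0[\,]=\epsilon$).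 For $\pi\in\mathfrak{S}_m$, $\pi_*:=21[\pi,1]$, i.e. $\pi_*=(\pi(1)+1)\cdots(\pi(m)+1)\,1$; and $\pi_{i*}=(\pi_i)_*$. *)

theory Defs
  imports
    "HOL-Library.Sublist"
    "HOL-Combinatorics.Multiset_Permutations"
    "HOL-Computational_Algebra.Polynomial"
begin

text \<open>Permutations are given in one-line notation, as lists of values from \<open>1\<close> to \<open>n\<close>.\<close>

type_synonym perm = "nat list"

definition Perms :: "nat \<Rightarrow> perm set" where
  "Perms n = permutations_of_set {1..n}"

definition AllPerms :: "perm set" where
  "AllPerms = (\<Union>n. Perms n)"

definition same_order :: "nat list \<Rightarrow> nat list \<Rightarrow> bool" where
  "same_order xs ys \<longleftrightarrow> length xs = length ys \<and>
     (\<forall>i < length xs. \<forall>j < length xs. xs ! i < xs ! j \<longleftrightarrow> ys ! i < ys ! j)"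

definition contains :: "perm \<Rightarrow> perm \<Rightarrow> bool" where
  "contains \<sigma> \<pi> \<longleftrightarrow> (\<exists>s. subseq s \<sigma> \<and> same_order s \<pi>)"

definition avoids :: "perm \<Rightarrow> perm \<Rightarrow> bool" where
  "avoids \<sigma> \<pi> \<longleftrightarrow> \<not> contains \<sigma> \<pi>"

definition Av :: "nat \<Rightarrow> perm set \<Rightarrow> perm set" where
  "Av n P = {\<sigma> \<in> Perms n. \<forall>\<pi> \<in> P. avoids \<sigma> \<pi>}"

text \<open>The indeterminate \<open>q\<close> is the polynomial variable. A statistic is a total function on
  lists; only its values on permutations are ever used.\<close>

definition F :: "(perm \<Rightarrow> nat) \<Rightarrow> nat \<Rightarrow> perm set \<Rightarrow> int poly" where
  "F st n P = (\<Sum>\<sigma> \<in> Av n P. monom 1 (st \<sigma>))"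

definition st_Wilf_equivalent :: "(perm \<Rightarrow> nat) \<Rightarrow> perm set \<Rightarrow> perm set \<Rightarrow> bool" where
  "st_Wilf_equivalent st P P' \<longleftrightarrow> (\<forall>n. F st n P = F st n P')"

text \<open>In the inflation \<open>\<tau>[\<sigma>\<^sub>1, \<dots>, \<sigma>\<^sub>k]\<close>, the values of a block lie directly above those of all
  blocks whose entry in \<open>\<tau>\<close> is smaller, so the block is shifted up by their total length. List
  positions count from 0. Meaningful when \<open>length \<sigma>s = length \<tau>\<close>.\<close>

definition inflation :: "perm \<Rightarrow> perm list \<Rightarrow> perm" where
  "inflation \<tau> \<sigma>s = concat (map
     (\<lambda>i. map (\<lambda>x. x + (\<Sum>j | j < length \<tau> \<and> \<tau> ! j < \<tau> ! i. length (\<sigma>s ! j))) (\<sigma>s ! i))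
     [0..<length \<tau>])"

definition iota :: "nat \<Rightarrow> perm" where
  "iota r = [1..<Suc r]"

definition star :: "perm \<Rightarrow> perm" where
  "star \<pi> = inflation [2, 1] [\<pi>, [1]]"

lemma inflation_eq:
  "inflation \<tau> \<sigma>s = concat (map
     (\<lambda>i. map (\<lambda>x. x + (\<Sum>j \<leftarrow> [0..<length \<tau>]. if \<tau> ! j < \<tau> ! i then length (\<sigma>s ! j) else 0)) (\<sigma>s ! i))
     [0..<length \<tau>])"
proof -
  have "(\<Sum>j | j < length \<tau> \<and> R j. g j) = (\<Sum>j \<leftarrow> [0..<length \<tau>]. if R j then g j else 0)"
    for R and g :: "nat \<Rightarrow> nat"
  proof -
    have "{j. j < length \<tau> \<and> R j} = {j \<in> {0..<length \<tau>}. R j}"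
      by auto
    thus ?thesis
      by (simp only: sum.inter_filter finite_atLeastLessThan interv_sum_list_conv_sum_set_nat set_upt)
  qed
  thus ?thesis
    by (simp add: inflation_def)
qed

lemma inflation_example: "inflation [2, 1, 3] [[1, 2, 3], [1], [2, 1]] = [2, 3, 4, 1, 6, 5]"
  by (simp add: inflation_eq upt_rec)

lemma star_eq: "star \<pi> = map Suc \<pi> @ [1]"
  by (simp add: star_def inflation_eq upt_rec)

end

theory Submission
  imports Defs
begin

text \<open>Every 312-avoider of size \<open>n + 1\<close> is uniquely \<open>213[a, 1, b] = a\<^sub>* \<oplus> b\<close>, and the pattern is a
  direct sum \<open>\<pi>\<^sub>1\<^sub>* \<oplus> \<dots> \<oplus> \<pi>\<^sub>r\<^sub>*\<close> of indecomposable blocks. If \<open>i\<close> is the largest number of leading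
  blocks contained in \<open>a\<^sub>*\<close>, then \<open>a\<^sub>* \<oplus> b\<close> avoids the pattern iff \<open>i < r\<close> and \<open>b\<close> avoids the sum of
  the remaining blocks. Moreover \<open>a\<^sub>*\<close> contains \<open>\<pi>\<^sub>1\<^sub>*\<close> iff \<open>a\<close> contains \<open>\<pi>\<^sub>1\<close>, while for \<open>i \<ge> 2\<close> it
  contains the sum of the first \<open>i\<close> blocks iff \<open>a\<close> does. Sorting by \<open>i\<close> expresses the generating
  function at \<open>n + 1\<close> through those of the \<open>\<pi>\<^sub>1\<close>-avoiders and of shorter sums at sizes at most \<open>n\<close>,
  so the theorem follows by strong induction on \<open>n\<close>, simultaneously for all lists of blocks.\<close>

section \<open>Direct sums and sums of starred blocks\<close>

definition dsum :: "perm \<Rightarrow> perm \<Rightarrow> perm" where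
  "dsum a b = a @ map ((+) (length a)) b"

lemma length_dsum [simp]: "length (dsum a b) = length a + length b"
  by (simp add: dsum_def)

lemma dsum_Nil [simp]: "dsum [] b = b" "dsum a [] = a"
  by (simp_all add: dsum_def map_idI)

lemma dsum_assoc: "dsum (dsum a b) c = dsum a (dsum b c)"
  by (simp add: dsum_def comp_def add.assoc)

text \<open>The argument lists the blocks without their stars. The recursion exposes the first
  summand to inductions; \<open>inflation_iota_star\<close> identifies the result with an inflation
  of an identity.\<close>

fun star_sum :: "perm list \<Rightarrow> perm" where
  "star_sum [] = []"
| "star_sum (p # ps) = dsum (star p) (star_sum ps)"

lemma length_star [simp]: "length (star p) = Suc (length p)"
  by (simp add: star_eq)

lemma star_sum_append: "star_sum (ps @ qs) = dsum (star_sum ps) (star_sum qs)"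
  by (induction ps) (simp_all add: dsum_assoc)

lemma star_sum_eq_Nil_iff [simp]: "star_sum ps = [] \<longleftrightarrow> ps = []"
  by (cases ps) (auto simp: dsum_def star_eq)

text \<open>In an inflation of an identity each block is shifted by the total length of the blocks
  before it. Appending a block therefore leaves the earlier ones untouched, whereas prepending one
  would shift them all.\<close>

lemma inflation_iota_snoc:
  "inflation (iota (Suc (length ss))) (ss @ [s]) = dsum (inflation (iota (length ss)) ss) s"
proof -
  have shift: "inflation (iota (length us)) us =
      concat (map (\<lambda>i. map (\<lambda>x. x + (\<Sum>j<i. length (us ! j))) (us ! i)) [0..<length us])"
    for us :: "perm list"
  proof -
    have "{j. j < length (iota (length us)) \<and> iota (length us) ! j < iota (length us) ! i} = {..<i}"
      if "i < length us" for i
      using that by (auto simp: iota_def simp del: upt_Suc)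
    moreover have "length (iota (length us)) = length us"
      by (simp add: iota_def del: upt_Suc)
    ultimately show ?thesis
      unfolding inflation_def by (intro arg_cong[where f = concat] map_cong) auto
  qed
  have len: "length (inflation (iota (length us)) us) = (\<Sum>j<length us. length (us ! j))"
    for us :: "perm list"
    by (simp add: shift length_concat comp_def interv_sum_list_conv_sum_set_nat lessThan_atLeast0)
  have "inflation (iota (length (ss @ [s]))) (ss @ [s]) = 
      concat (map (\<lambda>i. map (\<lambda>x. x + (\<Sum>j<i. length (ss ! j))) (ss ! i)) [0..<length ss]) @
      map (\<lambda>x. x + (\<Sum>j<length ss. length (ss ! j))) s"
    unfolding shift by (auto simp: nth_append intro!: arg_cong[where f = concat] map_cong)
  then show ?thesis
    unfolding dsum_def len by (simp add: shift add.commute)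
qed

lemma inflation_iota_star:
  "inflation (iota (length ps)) (map star ps) = star_sum ps"
proof (induction ps rule: rev_induct)
  case Nil
  show ?case by (simp add: inflation_def iota_def)
next
  case (snoc p ps)
  then show ?case
    using inflation_iota_snoc[of "map star ps" "star p"] by (simp add: star_sum_append)
qed

lemma inflation_213: "inflation [2, 1, 3] [a, [1], b] = dsum (star a) b"
  by (simp add: inflation_eq upt_rec dsum_def star_eq add.commute)

section \<open>Permutations and order isomorphism\<close>

lemma in_Perms_iff: "xs \<in> Perms n \<longleftrightarrow> distinct xs \<and> set xs = {1..n}"
  by (auto simp: Perms_def permutations_of_set_def)

lemma Perms_length: "xs \<in> Perms n \<Longrightarrow> length xs = n"
  by (metis in_Perms_iff distinct_card card_atLeastAtMost add_diff_cancel_right' Suc_eq_plus1)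

lemma finite_Av [simp]: "finite (Av n P)"
  by (simp add: Av_def Perms_def)

lemma AllPerms_iff: "p \<in> AllPerms \<longleftrightarrow> distinct p \<and> set p = {1..length p}"
  unfolding AllPerms_def using Perms_length in_Perms_iff by auto

lemma same_order_refl [simp]: "same_order xs xs"
  by (simp add: same_order_def)

lemma same_order_sym: "same_order xs ys \<Longrightarrow> same_order ys xs"
  by (simp add: same_order_def)

lemma same_order_trans: "same_order xs ys \<Longrightarrow> same_order ys zs \<Longrightarrow> same_order xs zs"
  by (simp add: same_order_def)

lemma same_order_map: "strict_mono g \<Longrightarrow> same_order (map g xs) xs"
  by (auto simp: same_order_def strict_mono_less)

lemma same_order_map_iff:
  assumes "strict_mono g" "strict_mono h"
  shows "same_order (map g xs) (map h ys) \<longleftrightarrow> same_order xs ys"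
  by (meson assms same_order_map same_order_sym same_order_trans)

text \<open>Both directions of the cross comparison are assumed because entries of the two pieces
  may coincide, so that one strict inequality does not settle the reverse one.\<close>

lemma same_order_append:
  assumes "same_order s t" "same_order s' t'"
    and "\<And>i j. i < length s \<Longrightarrow> j < length s' \<Longrightarrow> s ! i < s' ! j \<longleftrightarrow> t ! i < t' ! j"
    and "\<And>i j. i < length s \<Longrightarrow> j < length s' \<Longrightarrow> s' ! j < s ! i \<longleftrightarrow> t' ! j < t ! i"
  shows "same_order (s @ s') (t @ t')"
  using assms by (auto simp: same_order_def nth_append)

lemma same_order_append_imp:
  assumes "same_order (s @ s') u"
  shows "same_order s (take (length s) u)" "same_order s' (drop (length s) u)"
    and "\<And>i j. i < length s \<Longrightarrow> j < length s' \<Longrightarrow>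
      s ! i < s' ! j \<longleftrightarrow> take (length s) u ! i < drop (length s) u ! j"
proof -
  have len: "length s + length s' = length u"
    and ord: "\<And>i j. i < length u \<Longrightarrow> j < length u \<Longrightarrow> (s @ s') ! i < (s @ s') ! j \<longleftrightarrow> u ! i < u ! j"
    using assms by (auto simp: same_order_def)
  show "same_order s (take (length s) u)"
    unfolding same_order_def
  proof (intro conjI allI impI)
    fix i j assume "i < length s" "j < length s"
    then show "s ! i < s ! j \<longleftrightarrow> take (length s) u ! i < take (length s) u ! j"
      using ord[of i j] len by (simp add: nth_append)
  qed (use len in simp)
  show "same_order s' (drop (length s) u)"
    unfolding same_order_def
  proof (intro conjI allI impI)
    fix i j assume "i < length s'" "j < length s'"
    then show "s' ! i < s' ! j \<longleftrightarrow> drop (length s) u ! i < drop (length s) u ! j"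
      using ord[of "length s + i" "length s + j"] len by (simp add: nth_append)
  qed (use len in simp)
  fix i j assume "i < length s" "j < length s'"
  then show "s ! i < s' ! j \<longleftrightarrow> take (length s) u ! i < drop (length s) u ! j"
    using ord[of i "length s + j"] len by (simp add: nth_append)
qed

lemma subseq_imp_subset: "subseq xs ys \<Longrightarrow> set xs \<subseteq> set ys"
  by (auto simp: subseq_conv_nths dest: in_set_nthsD)

section \<open>Pattern containment\<close>

lemma contains_Nil [simp]: "contains \<sigma> []"
  unfolding contains_def by (intro exI[of _ "[]"]) simp

lemma contains_same_order: "same_order p q \<Longrightarrow> contains \<sigma> p \<longleftrightarrow> contains \<sigma> q"
  unfolding contains_def by (meson same_order_sym same_order_trans)

lemma contains_subseq: "subseq \<sigma> \<tau> \<Longrightarrow> contains \<sigma> p \<Longrightarrow> contains \<tau> p"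
  unfolding contains_def by (meson subseq_order.trans)

text \<open>A subsequence of \<open>map g \<sigma>\<close> is the image of the subsequence of
  \<open>\<sigma>\<close> at the same positions, and a strictly increasing \<open>g\<close>
  preserves relative order.\<close>

lemma contains_map:
  assumes "strict_mono g"
  shows "contains (map g \<sigma>) p \<longleftrightarrow> contains \<sigma> p"
proof
  assume "contains (map g \<sigma>) p"
  then obtain s where s: "subseq s (map g \<sigma>)" "same_order s p"
    by (auto simp: contains_def)
  then obtain N where "s = nths (map g \<sigma>) N"
    by (auto simp: subseq_conv_nths)
  then have "s = map g (nths \<sigma> N)"
    by (simp add: nths_map)
  then show "contains \<sigma> p"
    using s assms unfolding contains_def
    by (metis subseq_conv_nths same_order_map same_order_sym same_order_trans)
next
  assume "contains \<sigma> p"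
  then obtain s where "subseq s \<sigma>" "same_order s p"
    by (auto simp: contains_def)
  then show "contains (map g \<sigma>) p"
    unfolding contains_def
    by (meson subseq_map same_order_map same_order_trans assms)
qed

lemma strict_mono_plus [simp]: "strict_mono ((+) (k :: nat))"
  by (simp add: strict_mono_def)

lemma strict_mono_Suc [simp]: "strict_mono Suc"
  by (simp add: strict_mono_def)

lemma contains_append:
  assumes "contains \<sigma> (p @ q)"
  shows "contains \<sigma> p" "contains \<sigma> q"
proof -
  obtain s where s: "subseq s \<sigma>" "same_order s (p @ q)"
    using assms by (auto simp: contains_def)
  let ?m = "length p"
  have "same_order (take ?m s @ drop ?m s) (p @ q)" "length (take ?m s) = ?m"
    using s by (auto simp: same_order_def)
  from same_order_append_imp(1,2)[OF this(1)] this(2)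
  have "same_order (take ?m s) p" "same_order (drop ?m s) q" by simp_all
  moreover have "subseq (take ?m s) \<sigma>" "subseq (drop ?m s) \<sigma>"
    using s(1) by (meson prefix_imp_subseq suffix_imp_subseq subseq_order.trans
        take_is_prefix suffix_drop)+
  ultimately show "contains \<sigma> p" "contains \<sigma> q"
    unfolding contains_def by blast+
qed

lemma contains_pattern_map:
  "strict_mono g \<Longrightarrow> contains \<sigma> (map g p) \<longleftrightarrow> contains \<sigma> p"
  using contains_same_order same_order_map by blast

section \<open>Containment and direct sums\<close>

lemma contains_dsum:
  assumes "contains \<sigma> (dsum p q)"
  shows "contains \<sigma> p" "contains \<sigma> q"
  using contains_append[OF assms[unfolded dsum_def]] by (simp_all add: contains_pattern_map)

text \<open>Occurrences of \<open>p\<close> and \<open>q\<close> are placed side by side. The value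
  bounds put the left part strictly below the shifted right part, in the text as in the pattern, so
  the cross comparisons agree.\<close>

lemma contains_dsum_dsum:
  assumes "contains a p" "contains b q"
    and "\<forall>x\<in>set a. x \<le> length a" "\<forall>x\<in>set b. 0 < x"
    and "\<forall>x\<in>set p. x \<le> length p" "\<forall>x\<in>set q. 0 < x"
  shows "contains (dsum a b) (dsum p q)"
proof -
  obtain s t where s: "subseq s a" "same_order s p" and t: "subseq t b" "same_order t q"
    using assms(1,2) by (auto simp: contains_def)
  have sub: "set s \<subseteq> set a" "set t \<subseteq> set b"
    using s(1) t(1) by (simp_all add: subseq_imp_subset)
  let ?t = "map ((+) (length a)) t" and ?q = "map ((+) (length p)) q"
  have len: "length s = length p" "length t = length q"
    using s(2) t(2) by (auto simp: same_order_def)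
  have 1: "s ! i < ?t ! j" "p ! i < ?q ! j" if "i < length s" "j < length ?t" for i j
  proof -
    have "s ! i \<in> set a" "t ! j \<in> set b" "p ! i \<in> set p" "q ! j \<in> set q"
      using that sub len by auto
    then have "s ! i \<le> length a" "0 < t ! j" "p ! i \<le> length p" "0 < q ! j"
      using assms(3-6) by blast+
    then show "s ! i < ?t ! j" "p ! i < ?q ! j"
      using that len by auto
  qed
  have "same_order (s @ ?t) (p @ ?q)"
  proof (rule same_order_append)
    show "same_order ?t ?q" using t(2) by (simp add: same_order_map_iff)
  qed (use s(2) 1 in \<open>auto dest: less_asym\<close>)
  moreover have "subseq (s @ ?t) (dsum a b)"
    unfolding dsum_def by (intro list_emb_append_mono s(1) subseq_map t(1))
  ultimately show ?thesis
    unfolding contains_def dsum_def by blast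
qed

text \<open>An occurrence in a direct sum cuts the pattern at a point where everything to the left is
  smaller than everything to the right.\<close>

lemma contains_dsumE:
  assumes "contains (dsum a b) u"
    and "\<forall>x\<in>set a. x \<le> length a" "\<forall>x\<in>set b. 0 < x"
  obtains m where "m \<le> length u" "contains a (take m u)" "contains b (drop m u)"
    "\<And>i j. i < m \<Longrightarrow> m \<le> j \<Longrightarrow> j < length u \<Longrightarrow> u ! i < u ! j"
proof -
  obtain s where "subseq s (a @ map ((+) (length a)) b)" "same_order s u"
    using assms(1) by (auto simp: contains_def dsum_def)
  then obtain s1 s2 where s: "subseq s1 a" "subseq s2 (map ((+) (length a)) b)"
      "same_order (s1 @ s2) u"
    by (auto simp: subseq_append_iff elim!: subseq_appendE)
  have len: "length s1 + length s2 = length u"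
    using s(3) by (simp add: same_order_def)
  show ?thesis
  proof (rule that)
    show "length s1 \<le> length u" using len by simp
    show "contains a (take (length s1) u)"
      using s(1) same_order_append_imp(1)[OF s(3)] by (auto simp: contains_def)
    have "contains (map ((+) (length a)) b) (drop (length s1) u)"
      using s(2) same_order_append_imp(2)[OF s(3)] by (auto simp: contains_def)
    then show "contains b (drop (length s1) u)" by (simp add: contains_map)
    fix i j assume ij: "i < length s1" "length s1 \<le> j" "j < length u"
    let ?j = "j - length s1"
    have "s1 ! i \<in> set a" "s2 ! ?j \<in> set (map ((+) (length a)) b)"
      using ij len subseq_imp_subset[OF s(1)] subseq_imp_subset[OF s(2)] by (auto simp: subset_iff)
    then have "s1 ! i < s2 ! ?j"
      using assms(2,3) by fastforce
    then show "u ! i < u ! j"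
      using same_order_append_imp(3)[OF s(3), of i ?j] ij len by simp
  qed
qed

text \<open>Every block \<open>star p\<close> ends in its minimum, so a cut strictly inside a block
  would have to place the first entry of that block below its last. Only block boundaries
  remain.\<close>

lemma star_sum_cut:
  assumes "m \<le> length (star_sum ps)"
    and "\<And>i j. i < m \<Longrightarrow> m \<le> j \<Longrightarrow> j < length (star_sum ps) \<Longrightarrow> star_sum ps ! i < star_sum ps ! j"
  shows "\<exists>i\<le>length ps. take m (star_sum ps) = star_sum (take i ps) \<and>
    drop m (star_sum ps) = map ((+) m) (star_sum (drop i ps))"
  using assms
proof (induction ps arbitrary: m)
  case (Cons p ps)
  let ?u = "star_sum (p # ps)" and ?l = "Suc (length p)"
  have u: "?u = star p @ map ((+) ?l) (star_sum ps)"
    by (simp add: dsum_def)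
  consider "m = 0" | "0 < m" "m < ?l" | "?l \<le> m"
    by linarith
  then show ?case
  proof cases
    case 1
    then show ?thesis by (intro exI[of _ 0]) (simp add: map_idI)
  next
    case 2
    \<comment> \<open>\<open>length p\<close> is the position of the 1 that closes the first
      block.\<close>
    then have "?u ! 0 < ?u ! length p"
      by (intro Cons.prems(2)) auto
    with 2 show ?thesis
      by (simp add: u star_eq nth_append del: star_sum.simps split: if_splits)
  next
    case 3
    have "star_sum ps ! i < star_sum ps ! j"
      if "i < m - ?l" "m - ?l \<le> j" "j < length (star_sum ps)" for i j
    proof -
      have "?u ! (?l + i) < ?u ! (?l + j)"
        using that 3 by (intro Cons.prems(2)) auto
      then show ?thesis using that by (simp add: u nth_append del: star_sum.simps)
    qed
    moreover have "m - ?l \<le> length (star_sum ps)"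
      using Cons.prems(1) by simp
    ultimately obtain i where i: "i \<le> length ps"
        "take (m - ?l) (star_sum ps) = star_sum (take i ps)"
        "drop (m - ?l) (star_sum ps) = map ((+) (m - ?l)) (star_sum (drop i ps))"
      using Cons.IH by blast
    have "take m ?u = star_sum (take (Suc i) (p # ps))"
      using i(2) 3 by (simp add: u dsum_def take_map)
    moreover have "drop m ?u = map ((+) m) (star_sum (drop (Suc i) (p # ps)))"
      using 3 by (simp add: u i(3) drop_map comp_def del: star_sum.simps)
    ultimately show ?thesis
      using i(1) by (intro exI[of _ "Suc i"]) simp
  qed
qed simp

lemma set_star_sum:
  assumes "set ps \<subseteq> AllPerms" "x \<in> set (star_sum ps)"
  shows "0 < x \<and> x \<le> length (star_sum ps)"
  using assms
proof (induction ps arbitrary: x)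
  case (Cons p ps)
  then have "set p = {1..length p}" by (simp add: AllPerms_iff)
  with Cons show ?case
    by (fastforce simp: dsum_def star_eq)
qed simp

lemma star_sum_pos: "x \<in> set (star_sum ps) \<Longrightarrow> 0 < x"
  by (induction ps arbitrary: x) (auto simp: dsum_def star_eq)

text \<open>An occurrence cuts the pattern at a point which \<open>star_sum_cut\<close> forces to be
  a block boundary; conversely \<open>contains_dsum_dsum\<close> glues occurrences of the two groups
  of blocks.\<close>

lemma contains_dsum_star_sum:
  assumes "\<forall>x\<in>set a. x \<le> length a" "\<forall>x\<in>set b. 0 < x" "set ps \<subseteq> AllPerms"
  shows "contains (dsum a b) (star_sum ps) \<longleftrightarrow>
    (\<exists>i\<le>length ps. contains a (star_sum (take i ps)) \<and> contains b (star_sum (drop i ps)))"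
proof
  assume "contains (dsum a b) (star_sum ps)"
  then obtain m where "m \<le> length (star_sum ps)"
      "contains a (take m (star_sum ps))" "contains b (drop m (star_sum ps))"
      "\<And>i j. i < m \<Longrightarrow> m \<le> j \<Longrightarrow> j < length (star_sum ps) \<Longrightarrow> star_sum ps ! i < star_sum ps ! j"
    using contains_dsumE[OF _ assms(1,2)] by blast
  with star_sum_cut[of m ps] show "\<exists>i\<le>length ps.
      contains a (star_sum (take i ps)) \<and> contains b (star_sum (drop i ps))"
    by (auto simp: contains_pattern_map)
next
  assume "\<exists>i\<le>length ps. contains a (star_sum (take i ps)) \<and> contains b (star_sum (drop i ps))"
  then obtain i where i: "contains a (star_sum (take i ps))" "contains b (star_sum (drop i ps))"
    by blast
  have "set (take i ps) \<subseteq> AllPerms" "set (drop i ps) \<subseteq> AllPerms"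
    using assms(3) set_take_subset set_drop_subset by fast+
  then have "contains (dsum a b) (dsum (star_sum (take i ps)) (star_sum (drop i ps)))"
    by (intro contains_dsum_dsum i assms) (auto dest: set_star_sum)
  then show "contains (dsum a b) (star_sum ps)"
    by (simp flip: star_sum_append)
qed

section \<open>Containment in a starred permutation\<close>

text \<open>An occurrence that \<open>a\<close> alone cannot supply must use the final 1 of
  \<open>star a\<close>. No value is smaller, so the last entry of \<open>u\<close>, which this 1
  represents, is a minimum.\<close>

lemma contains_starD:
  assumes "contains (star a) u" "\<not> contains a u"
  shows "u \<noteq> []" "contains a (butlast u)" "\<And>i. i < length u \<Longrightarrow> last u \<le> u ! i"
proof -
  obtain s1 s2 where s: "subseq s1 (map Suc a)" "subseq s2 [1]" "same_order (s1 @ s2) u"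
    using assms(1) by (auto simp: contains_def star_eq subseq_append_iff)
  have "s2 = [] \<or> s2 = [1]"
    using s(2) by (cases s2) (auto split: if_splits)
  moreover have "s2 \<noteq> []"
    using s assms(2) contains_map[OF strict_mono_Suc, of a u] by (auto simp: contains_def)
  ultimately have s2: "s2 = [1]" by blast
  then have len: "length u = Suc (length s1)"
    using s(3) by (simp add: same_order_def)
  then show "u \<noteq> []" by auto
  have "contains (map Suc a) (take (length s1) u)"
    using s(1) same_order_append_imp(1)[OF s(3)] by (auto simp: contains_def)
  then show "contains a (butlast u)"
    using len by (simp add: contains_map butlast_conv_take)
  fix i assume i: "i < length u"
  have "(s1 @ [1]) ! i < (s1 @ [1]) ! length s1 \<longleftrightarrow> u ! i < u ! length s1"
    using s(3) i len unfolding same_order_def s2 by (metis length_append_singleton lessI)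
  moreover have "(s1 @ [1]) ! i > 0"
  proof -
    have "(s1 @ [1]) ! i \<in> set (s1 @ [1])"
      using i len by (intro nth_mem) simp
    then show ?thesis using subseq_imp_subset[OF s(1)] by auto
  qed
  ultimately show "last u \<le> u ! i"
    using len by (auto simp: last_conv_nth \<open>u \<noteq> []\<close>)
qed

lemma contains_star_mono: "contains a u \<Longrightarrow> contains (star a) u"
  by (metis contains_map contains_subseq star_eq strict_mono_Suc subseq_order.refl subseq_rev_drop_many)

text \<open>From left to right, the occurrence either lies within \<open>a\<close> already or loses
  only its last entry with the final 1 of \<open>star a\<close>; in both cases
  \<open>map Suc p\<close>, which is \<open>star p\<close> without its last entry, survives.
  Conversely, an occurrence of \<open>p\<close> is extended by the final 1.\<close>

lemma contains_star_star: 
  assumes "\<forall>x\<in>set a. 0 < x" "\<forall>x\<in>set p. 0 < x"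
  shows "contains (star a) (star p) \<longleftrightarrow> contains a p"
proof
  assume *: "contains (star a) (star p)"
  have "contains a (map Suc p)"
  proof (cases "contains a (star p)")
    case True
    then show ?thesis using contains_append(1) by (simp add: star_eq)
  next
    case False
    with contains_starD(2)[OF *] show ?thesis by (simp add: star_eq)
  qed
  then show "contains a p" by (simp add: contains_pattern_map)
next
  assume "contains a p"
  then obtain s where s: "subseq s a" "same_order s p"
    by (auto simp: contains_def)
  have "length s = length p" using s(2) by (simp add: same_order_def)
  moreover have "\<forall>x\<in>set s. 0 < x"
    using assms(1) subseq_imp_subset[OF s(1)] by blast
  ultimately have "same_order (map Suc s @ [1]) (map Suc p @ [1])"
    using s(2) assms(2) by (intro same_order_append) (auto simp: same_order_map_iff)
  moreover have "subseq (map Suc s @ [1]) (map Suc a @ [1])"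
    using s(1) by (simp add: subseq_map)
  ultimately show "contains (star a) (star p)"
    unfolding contains_def star_eq by blast
qed

text \<open>The pattern that \<open>a\<close> has to contain for \<open>star a\<close> to contain
  \<open>star_sum ps\<close>. Only a single block can use the final 1 of \<open>star a\<close>, and
  then that block sheds its star.\<close>

fun star_core :: "perm list \<Rightarrow> perm" where
  "star_core [p] = p"
| "star_core ps = star_sum ps"

text \<open>With at least two summands, the final entry of the pattern is not its minimum and so cannot
  be matched by the final entry of \<open>star a\<close>.\<close>

lemma contains_star_star_sum:
  assumes "\<forall>x\<in>set a. 0 < x" "set ps \<subseteq> AllPerms"
  shows "contains (star a) (star_sum ps) \<longleftrightarrow> contains a (star_core ps)"
proof (cases ps rule: star_core.cases)
  case ("2_2" p q qs)
  let ?v = "star_sum (q # qs)"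
  have u: "star_sum ps = star p @ map ((+) (Suc (length p))) ?v"
    by (simp add: "2_2" dsum_def)
  have v: "?v \<noteq> []" by (simp del: star_sum.simps)
  have "star_sum ps ! length p < last (star_sum ps)"
  proof -
    have "last (star_sum ps) = Suc (length p) + last ?v"
      using v last_map[OF v, of "(+) (Suc (length p))"] by (simp add: u del: star_sum.simps)
    moreover have "0 < last ?v"
      using star_sum_pos last_in_set v by blast
    moreover have "star_sum ps ! length p = 1"
      by (simp add: u star_eq nth_append del: star_sum.simps)
    ultimately show ?thesis by simp
  qed
  then have "contains a (star_sum ps)" if "contains (star a) (star_sum ps)"
    using contains_starD(3)[OF that, of "length p"] by (auto simp: u)
  then show ?thesis
    using contains_star_mono by (auto simp: "2_2")
qed (use assms in \<open>auto simp: AllPerms_iff intro!: contains_star_star\<close>)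

section \<open>The decomposition of 312-avoiders\<close>

lemma dsum_star_in_Perms:
  assumes "a \<in> Perms k" "b \<in> Perms m"
  shows "dsum (star a) b \<in> Perms (Suc (k + m))"
proof -
  have "length a = k" using assms(1) by (rule Perms_length)
  then have "set (dsum (star a) b) = Suc ` {1..k} \<union> {1} \<union> (+) (Suc k) ` {1..m}"
    using assms by (auto simp: dsum_def star_eq in_Perms_iff)
  also have "\<dots> = {1..Suc (k + m)}"
    by (simp only: image_Suc_atLeastAtMost image_add_atLeastAtMost) auto
  finally show ?thesis
    using assms \<open>length a = k\<close> by (auto simp: dsum_def star_eq in_Perms_iff distinct_map)
qed

text \<open>The value 1 occurs exactly once, so its position determines where the list splits; the
  shifts can then be undone.\<close>

lemma dsum_star_inj:
  assumes "a \<in> Perms k" "b \<in> Perms m" "a' \<in> Perms k'" "b' \<in> Perms m'"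
    and "dsum (star a) b = dsum (star a') b'"
  shows "a = a' \<and> b = b'"
proof -
  have "0 \<notin> set a" "0 \<notin> set b"
    using assms(1,2) by (auto simp: in_Perms_iff)
  then have "1 \<notin> set (map Suc a)" "1 \<notin> set (map ((+) (Suc (length a))) b)"
    by auto
  moreover have "map Suc a @ 1 # map ((+) (Suc (length a))) b =
      map Suc a' @ 1 # map ((+) (Suc (length a'))) b'"
    using assms(5) by (simp add: dsum_def star_eq)
  ultimately have "map Suc a = map Suc a' \<and>
      map ((+) (Suc (length a))) b = map ((+) (Suc (length a'))) b'"
    using append_Cons_eq_iff[of 1 "map Suc a" "map ((+) (Suc (length a))) b"
        "map Suc a'" "map ((+) (Suc (length a'))) b'"] by simp
  moreover from this have "a = a'"
    by (simp only: inj_map_eq_map inj_Suc)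
  ultimately show ?thesis
    by (simp only: inj_map_eq_map inj_on_add)
qed

text \<open>The pattern 312 is not a direct sum of shorter ones, so an occurrence lies in
  \<open>star a\<close> or in \<open>b\<close>; it does not end in its minimum, so it cannot use the
  final 1 of \<open>star a\<close>.\<close>

lemma contains_312_dsum_star:
  assumes "a \<in> Perms k" "b \<in> Perms m"
  shows "contains (dsum (star a) b) [3, 1, 2] \<longleftrightarrow> contains a [3, 1, 2] \<or> contains b [3, 1, 2]"
proof
  assume *: "contains (dsum (star a) b) [3, 1, 2]"
  have "\<forall>x\<in>set (star a). x \<le> length (star a)" "\<forall>x\<in>set b. 0 < x"
    using assms by (auto simp: star_eq in_Perms_iff Perms_length)
  from contains_dsumE[OF * this] obtain m where m: "m \<le> length [3, 1, 2 :: nat]"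
      "contains (star a) (take m [3, 1, 2])" "contains b (drop m [3, 1, 2])"
      and cut: "\<And>i j. i < m \<Longrightarrow> m \<le> j \<Longrightarrow> j < length [3, 1, 2 :: nat] \<Longrightarrow>
        [3, 1, 2 :: nat] ! i < [3, 1, 2] ! j"
    by blast
  have "m = 0 \<or> m = 3"
  proof (rule ccontr)
    assume "\<not> (m = 0 \<or> m = 3)"
    then have "0 < m" "m \<le> 2" using m(1) by auto
    \<comment> \<open>The entries 3 and 2, at positions 0 and 2, lie on opposite sides of such a cut
      and are in the wrong order.\<close>
    then show False using cut[of 0 2] by simp
  qed
  then show "contains a [3, 1, 2] \<or> contains b [3, 1, 2]"
    using m(2,3) contains_starD(3)[of a "[3, 1, 2]" 1] by (cases "contains a [3, 1, 2]") auto
next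
  assume "contains a [3, 1, 2] \<or> contains b [3, 1, 2]"
  then show "contains (dsum (star a) b) [3, 1, 2]"
  proof
    assume "contains a [3, 1, 2]"
    then have "contains (star a) [3, 1, 2]" by (rule contains_star_mono)
    then show ?thesis
      by (rule contains_subseq[rotated]) (simp add: dsum_def subseq_rev_drop_many)
  next
    assume "contains b [3, 1, 2]"
    then have "contains (map ((+) (length (star a))) b) [3, 1, 2]" by (simp add: contains_map)
    then show ?thesis
      by (rule contains_subseq[rotated]) (simp add: dsum_def subseq_drop_many)
  qed
qed

text \<open>Applied to the values before and after the entry 1. Nothing below \<open>Max A\<close>
  can lie in \<open>B\<close>, so \<open>A\<close> is an initial segment.\<close>

lemma atLeastAtMost_cut:
  fixes A B :: "nat set"
  assumes "A \<union> B = {l..u}" "\<And>x y. x \<in> A \<Longrightarrow> y \<in> B \<Longrightarrow> x < y"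
  shows "A = {l..<l + card A}" "B = {l + card A..u}"
proof -
  have fin: "finite A" using assms(1) by (metis finite_Un finite_atLeastAtMost)
  have "\<exists>h. A = {l..<h} \<and> l \<le> h"
  proof (cases "A = {}")
    case False
    have "A = {l..<Suc (Max A)}"
    proof (intro equalityI subsetI)
      fix x assume "x \<in> A"
      then show "x \<in> {l..<Suc (Max A)}" using assms(1) fin by (auto simp: less_Suc_eq_le)
    next
      fix x assume x: "x \<in> {l..<Suc (Max A)}"
      have "Max A \<in> A" using False fin by simp
      then have "Max A \<le> u" using assms(1) by auto
      then have "x \<in> A \<union> B" using x assms(1) by auto
      then show "x \<in> A" using assms(2)[OF \<open>Max A \<in> A\<close>, of x] x by auto
    qed
    moreover have "l \<le> Max A" using Max_in[OF fin False] assms(1) by auto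
    ultimately show ?thesis by (intro exI[of _ "Suc (Max A)"]) auto
  qed auto
  then obtain h where "A = {l..<h}" "l \<le> h" by blast
  then show A: "A = {l..<l + card A}" by simp
  have "A \<inter> B = {}" using assms(2) by blast
  then have "B = {l..u} - A" using assms(1) by blast
  then show "B = {l + card A..u}"
    by (subst (asm) A) auto
qed

text \<open>Split \<open>\<sigma>\<close> at its entry 1. An entry before it and a smaller one after
  it would form 312 together with the 1, so the values before lie below those after, and both sets
  of values are intervals.\<close>

lemma Perms_312_decompose:
  assumes "\<sigma> \<in> Perms (Suc n)" "\<not> contains \<sigma> [3, 1, 2]"
  obtains k a b where "k \<le> n" "a \<in> Perms k" "b \<in> Perms (n - k)" "\<sigma> = dsum (star a) b"
proof -
  have \<sigma>: "distinct \<sigma>" "set \<sigma> = {1..Suc n}"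
    using assms(1) by (auto simp: in_Perms_iff)
  then have "1 \<in> set \<sigma>" by simp
  then obtain xs ys where xy: "\<sigma> = xs @ 1 # ys"
    by (meson split_list)
  let ?k = "length xs"
  have "x < y" if "x \<in> set xs" "y \<in> set ys" for x y
  proof (rule ccontr)
    assume "\<not> x < y"
    moreover have "x \<noteq> y" "1 \<noteq> y" "y \<in> {1..Suc n}" using that \<sigma> by (auto simp: xy)
    ultimately have "same_order [x, 1, y] [3, 1, 2]"
      by (simp add: same_order_def All_less_Suc numeral_3_eq_3)
    moreover have "subseq ([x] @ 1 # [y]) \<sigma>"
      unfolding xy using that by (intro list_emb_append_mono) (auto simp: subseq_singleton_left)
    ultimately show False using assms(2) by (auto simp: contains_def)
  qed
  moreover have "set xs \<union> set ys = {2..Suc n}"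
  proof -
    have "set xs \<union> set ys = set \<sigma> - {1}" using \<sigma>(1) by (auto simp: xy)
    also have "\<dots> = {2..Suc n}" unfolding \<sigma>(2) by auto
    finally show ?thesis .
  qed
  moreover have "card (set xs) = ?k" using \<sigma>(1) by (simp add: xy distinct_card)
  ultimately have sets: "set xs = {2..<2 + ?k}" "set ys = {2 + ?k..Suc n}"
    using atLeastAtMost_cut[of "set xs" "set ys" 2 "Suc n"] by metis+
  have len: "?k + length ys = n"
    using Perms_length[OF assms(1)] by (simp add: xy)
  \<comment> \<open>The subtractions never truncate: the entries of \<open>xs\<close> are at least 2
    and those of \<open>ys\<close> at least \<open>2 + ?k\<close>.\<close>
  define a b where "a = map (\<lambda>x. x - 1) xs" and "b = map (\<lambda>x. x - Suc ?k) ys"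
  have xs: "xs = map Suc a"
    unfolding a_def map_map by (rule map_idI[symmetric]) (use sets in auto)
  have ys: "ys = map ((+) (Suc ?k)) b"
    unfolding b_def map_map by (rule map_idI[symmetric]) (use sets in auto)
  show ?thesis
  proof (rule that)
    show "?k \<le> n" using len by simp
    have "Suc ` set a = set xs"
      using arg_cong[OF xs, of set] by simp
    also have "\<dots> = Suc ` {1..?k}"
      unfolding sets(1) image_Suc_atLeastAtMost by auto
    finally have "Suc ` set a = Suc ` {1..?k}" .
    then have "set a = {1..?k}" by (simp only: inj_image_eq_iff inj_Suc)
    moreover have "distinct a"
      using distinct_map[of Suc a] \<sigma>(1) unfolding xy xs[symmetric] by simp
    ultimately show "a \<in> Perms ?k" by (simp add: in_Perms_iff)
    have "(+) (Suc ?k) ` set b = set ys"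
      using arg_cong[OF ys, of set] by simp
    also have "\<dots> = (+) (Suc ?k) ` {1..n - ?k}"
      unfolding sets(2) image_add_atLeastAtMost using len by auto
    finally have "(+) (Suc ?k) ` set b = (+) (Suc ?k) ` {1..n - ?k}" .
    then have "set b = {1..n - ?k}" by (simp only: inj_image_eq_iff inj_on_add)
    moreover have "distinct b"
      using distinct_map[of "(+) (Suc ?k)" b] \<sigma>(1) unfolding xy ys[symmetric] by simp
    ultimately show "b \<in> Perms (n - ?k)" by (simp add: in_Perms_iff)
    have "length a = ?k" by (simp add: a_def)
    then have "dsum (star a) b = map Suc a @ 1 # map ((+) (Suc ?k)) b"
      by (simp add: dsum_def star_eq)
    then show "\<sigma> = dsum (star a) b" by (simp only: xy flip: xs ys)
  qed
qed

text \<open>Reindexes sums over the avoiders of size \<open>Suc n\<close>. The component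
  \<open>k\<close> does not harm injectivity, since it is recovered as
  \<open>length a\<close>.\<close>

lemma bij_betw_Av_312:
  "bij_betw (\<lambda>(k, a, b). dsum (star a) b)
    (SIGMA k:{..n}. Av k {[3, 1, 2]} \<times> Av (n - k) {[3, 1, 2]}) (Av (Suc n) {[3, 1, 2]})"
  unfolding bij_betw_def
proof
  let ?S = "SIGMA k:{..n}. Av k {[3, 1, 2]} \<times> Av (n - k) {[3, 1, 2]}"
  let ?d = "\<lambda>(k :: nat, a, b). dsum (star a) b"
  show "inj_on ?d ?S"
  proof (rule inj_onI)
    fix x y assume xy: "x \<in> ?S" "y \<in> ?S" "?d x = ?d y"
    obtain k a b k' a' b' where [simp]: "x = (k, a, b)" "y = (k', a', b')"
      by (cases x, cases y)
    have "a = a' \<and> b = b'"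
      using xy by (intro dsum_star_inj[of a k b "n - k" a' k' b' "n - k'"]) (auto simp: Av_def)
    moreover have "k = length a" "k' = length a'"
      using xy by (auto simp: Av_def Perms_length)
    ultimately show "x = y" by simp
  qed
  show "?d ` ?S = Av (Suc n) {[3, 1, 2]}"
  proof (intro equalityI subsetI)
    fix x assume "x \<in> ?d ` ?S"
    then obtain k a b where x: "k \<le> n" "a \<in> Av k {[3, 1, 2]}" "b \<in> Av (n - k) {[3, 1, 2]}"
        "x = dsum (star a) b"
      by auto
    then show "x \<in> Av (Suc n) {[3, 1, 2]}"
      using dsum_star_in_Perms[of a k b "n - k"] contains_312_dsum_star[of a k b "n - k"]
      by (simp add: Av_def avoids_def)
  next
    fix x assume x: "x \<in> Av (Suc n) {[3, 1, 2]}"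
    then obtain k a b where kab: "k \<le> n" "a \<in> Perms k" "b \<in> Perms (n - k)" "x = dsum (star a) b"
      using Perms_312_decompose[of x n] by (auto simp: Av_def avoids_def)
    then have "(k, a, b) \<in> ?S"
      using x contains_312_dsum_star[of a k b "n - k"] by (simp add: Av_def avoids_def)
    then show "x \<in> ?d ` ?S"
      using kab(4) by force
  qed
qed

section \<open>Sorting pairs by the number of leading blocks on the left\<close>

text \<open>\<open>G i\<close> stands for the first \<open>i\<close> blocks fitting on the left,
  \<open>H i\<close> for the others fitting on the right. As \<open>i\<close> grows,
  \<open>G\<close> gets harder and \<open>H\<close> easier, so the best cut is at the last
  \<open>i\<close> with \<open>G i\<close>; all cuts fail precisely when this \<open>i\<close> is
  below \<open>r\<close> and \<open>H i\<close> fails.\<close>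

lemma cut_unique_iff:
  fixes G H :: "nat \<Rightarrow> bool"
  assumes "G 0" "\<And>i. i < r \<Longrightarrow> G (Suc i) \<Longrightarrow> G i"
    and "H r" "\<And>i. i < r \<Longrightarrow> H i \<Longrightarrow> H (Suc i)"
  shows "(\<exists>i\<le>r. G i \<and> H i) \<longleftrightarrow> \<not> (\<exists>i<r. G i \<and> \<not> G (Suc i) \<and> \<not> H i)"
    and "i < r \<Longrightarrow> j < r \<Longrightarrow> G i \<Longrightarrow> \<not> G (Suc i) \<Longrightarrow> G j \<Longrightarrow> \<not> G (Suc j) \<Longrightarrow> i = j"
proof -
  have G: "G i" if "i \<le> j" "j \<le> r" "G j" for i j
    using that by (induction rule: inc_induct) (use assms(2) in auto)
  have H: "H j" if "i \<le> j" "j \<le> r" "H i" for i j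
    using that by (induction rule: dec_induct) (use assms(4) in auto)
  show "(\<exists>i\<le>r. G i \<and> H i) \<longleftrightarrow> \<not> (\<exists>i<r. G i \<and> \<not> G (Suc i) \<and> \<not> H i)"
  proof
    assume "\<exists>i\<le>r. G i \<and> H i"
    then obtain i where i: "i \<le> r" "G i" "H i" by blast
    show "\<not> (\<exists>i<r. G i \<and> \<not> G (Suc i) \<and> \<not> H i)"
    proof
      assume "\<exists>i<r. G i \<and> \<not> G (Suc i) \<and> \<not> H i"
      then obtain j where j: "j < r" "\<not> G (Suc j)" "\<not> H j" by blast
      show False
        using G[of "Suc j" i] H[of i j] i j by (cases "i \<le> j") auto
    qed
  next
    assume *: "\<not> (\<exists>i<r. G i \<and> \<not> G (Suc i) \<and> \<not> H i)"
    show "\<exists>i\<le>r. G i \<and> H i"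
    proof (rule ccontr)
      assume "\<not> (\<exists>i\<le>r. G i \<and> H i)"
      then have "G i" if "i \<le> r" for i
        using that * assms(1) by (induction i) auto
      then show False using \<open>\<not> (\<exists>i\<le>r. G i \<and> H i)\<close> assms(3) by blast
    qed
  qed
  show "i = j" if "i < r" "j < r" "G i" "\<not> G (Suc i)" "G j" "\<not> G (Suc j)"
    using that G[of "Suc i" j] G[of "Suc j" i] by (metis Suc_leI less_imp_le nat_neq_iff)
qed

text \<open>\<open>D i\<close> collects the pairs for which \<open>i\<close> is the largest number
  of leading blocks contained in \<open>star a\<close>, while \<open>b\<close> avoids the sum of the
  others. The inclusion makes the generating function of the possible \<open>a\<close> a difference
  of two.\<close>

lemma Av_dsum_star_pairs:
  fixes ps k m
  assumes "set ps \<subseteq> AllPerms"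
  defines "D \<equiv> \<lambda>i. (Av k {[3, 1, 2], star_core (take (Suc i) ps)} -
      Av k {[3, 1, 2], star_core (take i ps)}) \<times> Av m {[3, 1, 2], star_sum (drop i ps)}"
  shows "{(a, b) \<in> Av k {[3, 1, 2]} \<times> Av m {[3, 1, 2]}. avoids (dsum (star a) b) (star_sum ps)} =
      (\<Union>i<length ps. D i)" (is "?L = ?R")
    and "i < length ps \<Longrightarrow> j < length ps \<Longrightarrow> i \<noteq> j \<Longrightarrow> D i \<inter> D j = {}"
    and "i < length ps \<Longrightarrow>
      Av k {[3, 1, 2], star_core (take i ps)} \<subseteq> Av k {[3, 1, 2], star_core (take (Suc i) ps)}"
proof -
  define G where "G a i = contains a (star_core (take i ps))" for a i
  define H where "H b i = contains b (star_sum (drop i ps))" for b i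
  have take: "set (take i ps) \<subseteq> AllPerms" for i
    using assms(1) set_take_subset by fast
  have pos: "\<forall>x\<in>set a. 0 < x" if "a \<in> Perms l" for a l
    using that by (auto simp: in_Perms_iff)
  have G_eq: "G a i \<longleftrightarrow> contains (star a) (star_sum (take i ps))" if "a \<in> Perms k" for a i
    unfolding G_def using contains_star_star_sum[OF pos[OF that] take] by simp
  have G0: "G a 0" for a
    by (simp add: G_def)
  \<comment> \<open>Monotonicity is read off from \<open>star_sum\<close>, where one more block is
    one more summand; \<open>star_core\<close> changes its form at length 1.\<close>
  have GS: "G a i" if "a \<in> Perms k" "i < length ps" "G a (Suc i)" for a i
    using that(3) unfolding G_eq[OF that(1)] take_Suc_conv_app_nth[OF that(2)] star_sum_append
    by (rule contains_dsum)
  have Hr: "H b (length ps)" for b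
    by (simp add: H_def)
  have HS: "H b (Suc i)" if "i < length ps" "H b i" for b i
    using that(2) contains_dsum(2) unfolding H_def Cons_nth_drop_Suc[OF that(1), symmetric]
    by auto
  have cut1: "(\<exists>i\<le>length ps. G a i \<and> H b i) \<longleftrightarrow>
      \<not> (\<exists>i<length ps. G a i \<and> \<not> G a (Suc i) \<and> \<not> H b i)" if "a \<in> Perms k" for a b
    using G0 GS[OF that] Hr HS by (rule cut_unique_iff(1))
  have cut2: "i = j" if "a \<in> Perms k" "i < length ps" "j < length ps"
      "G a i" "\<not> G a (Suc i)" "G a j" "\<not> G a (Suc j)" for a i j
    using G0 GS[OF that(1)] Hr HS that(2-) by (rule cut_unique_iff(2))
  have contains_iff: "contains (dsum (star a) b) (star_sum ps) \<longleftrightarrow> (\<exists>i\<le>length ps. G a i \<and> H b i)"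
    if "a \<in> Perms k" "b \<in> Perms m" for a b
  proof -
    have "\<forall>x\<in>set (star a). x \<le> length (star a)"
      using that(1) by (auto simp: star_eq in_Perms_iff Perms_length)
    then show ?thesis
      using contains_dsum_star_sum[OF _ pos[OF that(2)] assms(1)] G_eq[OF that(1)]
      by (simp add: H_def)
  qed
  have D: "D i = {(a, b) \<in> Av k {[3, 1, 2]} \<times> Av m {[3, 1, 2]}. G a i \<and> \<not> G a (Suc i) \<and> \<not> H b i}"
    for i
    by (auto simp: D_def Av_def avoids_def G_def H_def)
  show "?L = ?R"
    unfolding D using contains_iff cut1 by (auto simp: Av_def avoids_def)
  show "D i \<inter> D j = {}" if "i < length ps" "j < length ps" "i \<noteq> j"
    unfolding D using cut2[of _ i j] that by (auto simp: Av_def)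
  show "Av k {[3, 1, 2], star_core (take i ps)} \<subseteq> Av k {[3, 1, 2], star_core (take (Suc i) ps)}"
    if "i < length ps"
    using GS that by (auto simp: Av_def avoids_def G_def)
qed

section \<open>The recurrence and the induction on the size\<close>

text \<open>The bijection turns the sum into one over triples, the hypothesis on \<open>st\<close>
  makes each weight a product, and on each \<open>D i\<close> the sum over pairs factors.\<close>

lemma F_Suc:
  assumes st_213: "\<And>n k a b. k \<le> n \<Longrightarrow> a \<in> Av k {[3, 1, 2]} \<Longrightarrow> b \<in> Av (n - k) {[3, 1, 2]} \<Longrightarrow>
      st (dsum (star a) b) = f (k, n - k) + st a + st b"
    and ps: "set ps \<subseteq> AllPerms"
  shows "F st (Suc n) {[3, 1, 2], star_sum ps} = (\<Sum>k\<le>n. monom 1 (f (k, n - k)) *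
    (\<Sum>i<length ps. (F st k {[3, 1, 2], star_core (take (Suc i) ps)} -
        F st k {[3, 1, 2], star_core (take i ps)}) * F st (n - k) {[3, 1, 2], star_sum (drop i ps)}))"
proof -
  let ?A = "\<lambda>k. Av k {[3, 1, 2]}"
  let ?av = "\<lambda>a b. avoids (dsum (star a) b) (star_sum ps)"
  let ?m = "\<lambda>x. monom (1 :: int) (st x)"
  \<comment> \<open>Avoidance of the pattern moves into the summand, so that the index set is
    exactly the target of the bijection.\<close>
  have "F st (Suc n) {[3, 1, 2], star_sum ps} =
      (\<Sum>\<sigma>\<in>?A (Suc n). if avoids \<sigma> (star_sum ps) then ?m \<sigma> else 0)"
    unfolding F_def by (intro sum.mono_neutral_cong_left) (auto simp: Av_def Perms_def)
  also have "\<dots> = (\<Sum>(k, a, b)\<in>(SIGMA k:{..n}. ?A k \<times> ?A (n - k)).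
      if ?av a b then ?m (dsum (star a) b) else 0)"
    by (subst sum.reindex_bij_betw[OF bij_betw_Av_312, symmetric]) (auto intro!: sum.cong)
  also have "\<dots> = (\<Sum>k\<le>n. \<Sum>(a, b)\<in>?A k \<times> ?A (n - k). if ?av a b then ?m (dsum (star a) b) else 0)"
    by (subst sum.Sigma[symmetric]) (auto simp: case_prod_unfold)
  also have "\<dots> = (\<Sum>k\<le>n. monom 1 (f (k, n - k)) *
    (\<Sum>i<length ps. (F st k {[3, 1, 2], star_core (take (Suc i) ps)} -
        F st k {[3, 1, 2], star_core (take i ps)}) * F st (n - k) {[3, 1, 2], star_sum (drop i ps)}))"
  proof (rule sum.cong)
    fix k assume "k \<in> {..n}"
    then have k: "k \<le> n" by simp
    define D where "D i = (Av k {[3, 1, 2], star_core (take (Suc i) ps)} -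
      Av k {[3, 1, 2], star_core (take i ps)}) \<times> Av (n - k) {[3, 1, 2], star_sum (drop i ps)}" for i
    note pairs = Av_dsum_star_pairs(1,2)[where k = k and m = "n - k", OF ps, folded D_def]
    let ?L = "{(a, b) \<in> ?A k \<times> ?A (n - k). ?av a b}"
    have "(\<Sum>(a, b)\<in>?A k \<times> ?A (n - k). if ?av a b then ?m (dsum (star a) b) else 0) =
        (\<Sum>(a, b)\<in>?L. ?m (dsum (star a) b))"
      by (intro sum.mono_neutral_cong_right) (auto split: if_splits)
    also have "\<dots> = (\<Sum>(a, b)\<in>?L. monom 1 (f (k, n - k)) * (?m a * ?m b))"
      by (intro sum.cong) (auto simp: st_213[OF k] mult_monom add.assoc)
    also have "\<dots> = monom 1 (f (k, n - k)) * (\<Sum>(a, b)\<in>?L. ?m a * ?m b)"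
      by (simp add: sum_distrib_left case_prod_unfold)
    also have "(\<Sum>(a, b)\<in>?L. ?m a * ?m b) = (\<Sum>i<length ps. \<Sum>(a, b)\<in>D i. ?m a * ?m b)"
      unfolding pairs(1) by (intro sum.UNION_disjoint ballI impI pairs(2)) (simp_all add: D_def)
    also have "\<dots> = (\<Sum>i<length ps. (F st k {[3, 1, 2], star_core (take (Suc i) ps)} -
        F st k {[3, 1, 2], star_core (take i ps)}) * F st (n - k) {[3, 1, 2], star_sum (drop i ps)})"
    proof (rule sum.cong)
      fix i assume "i \<in> {..<length ps}"
      \<comment> \<open>The classes are nested, so summing over their difference subtracts the
        generating functions.\<close>
      then have "Av k {[3, 1, 2], star_core (take i ps)} \<subseteq> Av k {[3, 1, 2], star_core (take (Suc i) ps)}"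
        using Av_dsum_star_pairs(3)[OF ps] by simp
      then show "(\<Sum>(a, b)\<in>D i. ?m a * ?m b) = (F st k {[3, 1, 2], star_core (take (Suc i) ps)} -
        F st k {[3, 1, 2], star_core (take i ps)}) * F st (n - k) {[3, 1, 2], star_sum (drop i ps)}"
        unfolding D_def F_def
        by (simp add: sum_diff sum_product left_diff_distrib flip: sum.cartesian_product)
    qed simp
    finally show "(\<Sum>(a, b)\<in>?A k \<times> ?A (n - k). if ?av a b then ?m (dsum (star a) b) else 0) =
        monom 1 (f (k, n - k)) * (\<Sum>i<length ps. (F st k {[3, 1, 2], star_core (take (Suc i) ps)} -
          F st k {[3, 1, 2], star_core (take i ps)}) * F st (n - k) {[3, 1, 2], star_sum (drop i ps)})" .
  qed simp
  finally show ?thesis .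
qed

text \<open>The only permutation of size 0 is empty and contains no pattern but the empty
  one.\<close>

lemma F_0_cong:
  assumes "u = [] \<longleftrightarrow> v = []"
  shows "F st 0 {[3, 1, 2], u} = F st 0 {[3, 1, 2], v}"
proof -
  have "contains [] w \<longleftrightarrow> w = []" for w
    by (auto simp: contains_def same_order_def dest: list_emb_Nil2)
  then have "Av 0 {[3, 1, 2], u} = Av 0 {[3, 1, 2], v}"
    using assms by (auto simp: Av_def avoids_def Perms_def)
  then show ?thesis by (simp add: F_def)
qed

text \<open>The summand with \<open>i = 0\<close> still involves all of \<open>ps\<close>, at a
  smaller size, so the induction is on \<open>n\<close> rather than on the number of blocks; the
  lists vary because their initial and final segments occur as well.\<close>

lemma F_star_sum_cong:
  assumes st_213: "\<And>n k a b. k \<le> n \<Longrightarrow> a \<in> Av k {[3, 1, 2]} \<Longrightarrow> b \<in> Av (n - k) {[3, 1, 2]} \<Longrightarrow>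
      st (dsum (star a) b) = f (k, n - k) + st a + st b"
    and "set ps \<subseteq> AllPerms" "set ps' \<subseteq> AllPerms"
    and "list_all2 (\<lambda>p p'. st_Wilf_equivalent st {[3, 1, 2], p} {[3, 1, 2], p'}) ps ps'"
  shows "F st n {[3, 1, 2], star_sum ps} = F st n {[3, 1, 2], star_sum ps'}"
  using assms(2-)
proof (induction n arbitrary: ps ps' rule: less_induct)
  case (less n)
  have len: "length ps = length ps'"
    using less.prems(3) by (rule list_all2_lengthD)
  show ?case
  proof (cases n)
    case 0
    show ?thesis unfolding 0 by (rule F_0_cong) (use len in auto)
  next
    case (Suc m)
    have sub: "set (take i ps) \<subseteq> AllPerms" "set (take i ps') \<subseteq> AllPerms"
        "set (drop i ps) \<subseteq> AllPerms" "set (drop i ps') \<subseteq> AllPerms" for i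
      using less.prems(1,2) set_take_subset set_drop_subset by fast+
    have core: "F st k {[3, 1, 2], star_core (take i ps)} = F st k {[3, 1, 2], star_core (take i ps')}"
      if "k \<le> m" for k i
    proof -
      let ?E = "\<lambda>p p'. st_Wilf_equivalent st {[3, 1, 2], p} {[3, 1, 2], p'}"
      have *: "list_all2 ?E (take i ps) (take i ps')"
        using less.prems(3) by (rule list_all2_takeI)
      have IH: "F st k {[3, 1, 2], star_sum (take i ps)} = F st k {[3, 1, 2], star_sum (take i ps')}"
        using that Suc by (intro less.IH sub *) simp
      show ?thesis
      \<comment> \<open>The core of a single block is the block itself, and here the assumed
        equivalence enters; for all other lengths the core is the \<open>star_sum\<close> covered by
        \<open>IH\<close>.\<close>
      proof (cases "length (take i ps) = 1")
        case True
        then obtain p where p: "take i ps = [p]" by (auto simp: length_Suc_conv simp del: length_take)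
        with * obtain p' where "take i ps' = [p']" "?E p p'"
          by (auto simp: list_all2_Cons1)
        with p show ?thesis by (simp add: st_Wilf_equivalent_def)
      next
        case False
        then have "star_core qs = star_sum qs" if "length qs = length (take i ps)" for qs
          using that by (cases qs rule: star_core.cases) auto
        with IH list_all2_lengthD[OF *] show ?thesis by simp
      qed
    qed
    have drop: "F st (m - k) {[3, 1, 2], star_sum (drop i ps)} =
        F st (m - k) {[3, 1, 2], star_sum (drop i ps')}" for k i
      using Suc by (intro less.IH sub list_all2_dropI less.prems(3)) simp
    have rec: "F st (Suc m) {[3, 1, 2], star_sum qs} = (\<Sum>k\<le>m. monom 1 (f (k, m - k)) *
        (\<Sum>i<length qs. (F st k {[3, 1, 2], star_core (take (Suc i) qs)} -
          F st k {[3, 1, 2], star_core (take i qs)}) *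
          F st (m - k) {[3, 1, 2], star_sum (drop i qs)}))"
      if "set qs \<subseteq> AllPerms" for qs
      using st_213 that by (rule F_Suc)
    show ?thesis
      unfolding Suc rec[OF less.prems(1)] rec[OF less.prems(2)]
      by (intro sum.cong refl) (simp only: core drop len atMost_iff)
  qed
qed

theorem corollary2p6:
  fixes st :: "perm \<Rightarrow> nat"
    and f :: "nat \<times> nat \<Rightarrow> nat"
    and r :: nat
    and \<pi> \<pi>' :: "nat \<Rightarrow> perm"
  assumes st_213: "\<And>n k \<sigma>\<^sub>1 \<sigma>\<^sub>2. k \<le> n \<Longrightarrow> \<sigma>\<^sub>1 \<in> Av k {[3, 1, 2]} \<Longrightarrow> \<sigma>\<^sub>2 \<in> Av (n - k) {[3, 1, 2]} \<Longrightarrow>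
      st (inflation [2, 1, 3] [\<sigma>\<^sub>1, [1], \<sigma>\<^sub>2]) = f (k, n - k) + st \<sigma>\<^sub>1 + st \<sigma>\<^sub>2"
    and perms: "\<And>i. i \<in> {1..r} \<Longrightarrow> \<pi> i \<in> AllPerms"
    and perms': "\<And>i. i \<in> {1..r} \<Longrightarrow> \<pi>' i \<in> AllPerms"
    and equiv: "\<And>i. i \<in> {1..r} \<Longrightarrow> st_Wilf_equivalent st {[3, 1, 2], \<pi> i} {[3, 1, 2], \<pi>' i}"
  shows "st_Wilf_equivalent st
      {[3, 1, 2], inflation (iota r) (map (\<lambda>i. star (\<pi> i)) [1..<Suc r])}
      {[3, 1, 2], inflation (iota r) (map (\<lambda>i. star (\<pi>' i)) [1..<Suc r])}"
proof -
  have infl: "inflation (iota r) (map (\<lambda>i. star (\<rho> i)) [1..<Suc r]) = star_sum (map \<rho> [1..<Suc r])"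
    for \<rho> :: "nat \<Rightarrow> perm"
    using inflation_iota_star[of "map \<rho> [1..<Suc r]"] by (simp add: comp_def del: upt_Suc)
  have "F st n {[3, 1, 2], star_sum (map \<pi> [1..<Suc r])} =
      F st n {[3, 1, 2], star_sum (map \<pi>' [1..<Suc r])}" for n
  proof (rule F_star_sum_cong)
    show "st (dsum (star a) b) = f (k, n - k) + st a + st b"
      if "k \<le> n" "a \<in> Av k {[3, 1, 2]}" "b \<in> Av (n - k) {[3, 1, 2]}" for n k a b
      using st_213[OF that] by (simp only: inflation_213)
    show "set (map \<pi> [1..<Suc r]) \<subseteq> AllPerms" "set (map \<pi>' [1..<Suc r]) \<subseteq> AllPerms"
      using perms perms' by (auto simp del: upt_Suc)
    show "list_all2 (\<lambda>p p'. st_Wilf_equivalent st {[3, 1, 2], p} {[3, 1, 2], p'})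
        (map \<pi> [1..<Suc r]) (map \<pi>' [1..<Suc r])"
      using equiv by (auto simp: list_all2_conv_all_nth simp del: upt_Suc)
  qed
  then show ?thesis
    unfolding infl st_Wilf_equivalent_def by blast
qed

end
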